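(* Let $N<D$, let $X\in\mathbb{R}^{N\times D}$ be a full-rank data matrix (i.e. $\operatorname{rank}X=N$) with labels $\mathbf{y}\in\{-1,+1\}^N$, such that the dataset is linearly separable, i.e. there is $\boldsymbol{\beta}^*\in\mathbb{R}^D$ with $y_n\mathbf{x}_n^\top\boldsymbol{\beta}^*\ge 1$ for all $n$, where $\mathbf{x}_n^\top$ are the rows of $X$. Let $A\in\mathbb{R}^{D\times D}$ be invertible. Let $\boldsymbol{\beta}_t$, $t\in[0,T)$, be a trajectory of natural gradient flow for the linear classifier under logistic loss on data $(X,\mathbf{y})$, and let $\boldsymbol{\beta}'_t$, $t\in[0,T)$, be a trajectory of natural gradient flow for the linear classifier under logistic loss on the transformed data $(XA^\top,\mathbf{y})$ (so $\mathbf{x}_n$ is replaced by $A\mathbf{x}_n$). Assume the initial conditions are equivalent, i.e. $X\boldsymbol{\beta}_0=XA^\top\boldsymbol{\beta}'_0$. Then $$X\boldsymbol{\beta}_t=XA^\top\boldsymbol{\beta}'_t\qquad\text{for all }t\in[0,T).$$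
   Context: For a dataset $(Z,\mathbf{y})$ with $Z\in\mathbb{R}^{N\times D}$ having rows $\mathbf{z}_1^\top,\dots,\mathbf{z}_N^\top$ and $\mathbf{y}\in\{-1,+1\}^N$, the linear logistic model with parameter $\boldsymbol{\beta}\in\mathbb{R}^D$ is $p(y\mid\mathbf{z},\boldsymbol{\beta})=\frac{1}{1+e^{-y\mathbf{z}^\top\boldsymbol{\beta}}}$ for $y\in\{-1,+1\}$. Put $\ell(\boldsymbol{\beta},\mathbf{z},y)=-\log p(y\mid\mathbf{z},\boldsymbol{\beta})=\log(1+e^{-y\mathbf{z}^\top\boldsymbol{\beta}})$. The loss is $\mathcal{L}(\boldsymbol{\beta})=\sum_{n=1}^N\ell(\boldsymbol{\beta},\mathbf{z}_n,y_n)$. The (average) Fisher information matrix, averaged over the training inputs, is $$F(\boldsymbol{\beta})=\frac1N\sum_{n=1}^N\mathbb{E}_{y\sim p(\cdot\mid\mathbf{z}_n,\boldsymbol{\beta})}\left[\nabla_{\boldsymbol{\beta}}\ell(\boldsymbol{\beta},\mathbf{z}_n,y)\,\nabla_{\boldsymbol{\beta}}\ell(\boldsymbol{\beta},\mathbf{z}_n,y)^\top\right].$$ $F$ need not be invertible. A trajectory of natural gradient flow (NGF) on $(Z,\mathbf{y})$ is any differentiable curve $\boldsymbol{\beta}_t$ satisfying $F(\boldsymbol{\beta}_t)\dot{\boldsymbol{\beta}}_t=-\nabla_{\boldsymbol{\beta}}\mathcal{L}(\boldsymbol{\beta}_t)$. *)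

theory Defs
  imports "HOL-Analysis.Analysis"
begin

definition gradient :: "('a::real_inner \<Rightarrow> real) \<Rightarrow> 'a \<Rightarrow> 'a"
  where "gradient f x = (THE g. GDERIV f x :> g)"

lemma gradient_eqI:
  assumes "GDERIV f x :> g"
  shows "gradient f x = g"
  unfolding gradient_def
proof (rule the_equality[where P = "\<lambda>g. GDERIV f x :> g", OF assms])
  fix h assume "GDERIV f x :> h"
  then have "(\<lambda>k. k \<bullet> h) = (\<lambda>k. k \<bullet> g)"
    using assms unfolding gderiv_def by (rule has_derivative_unique)
  then have "(h - g) \<bullet> h = (h - g) \<bullet> g" by metis
  then have "(h - g) \<bullet> (h - g) = 0" by (simp add: inner_diff_right)
  then show "h = g" by simp
qed

definition logistic_prob :: "real \<Rightarrow> real^'d \<Rightarrow> real^'d \<Rightarrow> real"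
  where "logistic_prob y z \<beta> = 1 / (1 + exp (- y * (z \<bullet> \<beta>)))"

text \<open>The following two facts show that \<open>logistic_prob \<cdot> z \<beta>\<close> is a probability mass
  function on \<open>{-1, 1}\<close>, so that weighted sums over \<open>{-1, 1}\<close> are expectations.\<close>

lemma logistic_prob_pos: "logistic_prob y z \<beta> > 0"
  unfolding logistic_prob_def by (simp add: add_pos_pos)

lemma sum_logistic_prob: "(\<Sum>y\<in>{-1, 1}. logistic_prob y z \<beta>) = 1"
proof -
  have "1 + exp (z \<bullet> \<beta>) > 0" by (simp add: add_pos_pos)
  then show ?thesis
    by (simp add: logistic_prob_def exp_minus field_simps)
qed

definition logistic_loss :: "real^'d \<Rightarrow> real^'d \<Rightarrow> real \<Rightarrow> real"
  where "logistic_loss \<beta> z y = - ln (logistic_prob y z \<beta>)"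

definition total_loss :: "real^'d^'n \<Rightarrow> real^'n \<Rightarrow> real^'d \<Rightarrow> real"
  where "total_loss Z y \<beta> = (\<Sum>n\<in>UNIV. logistic_loss \<beta> (row n Z) (y $ n))"

definition outer_product :: "real^'d \<Rightarrow> real^'d \<Rightarrow> real^'d^'d"
  where "outer_product u v = (\<chi> i j. u $ i * v $ j)"

definition fisher_information :: "real^'d^'n \<Rightarrow> real^'d \<Rightarrow> real^'d^'d"
  where "fisher_information Z \<beta> =
    (1 / real CARD('n)) *\<^sub>R
      (\<Sum>n\<in>UNIV. \<Sum>y\<in>{-1, 1}. logistic_prob y (row n Z) \<beta> *\<^sub>R
        outer_product (gradient (\<lambda>b. logistic_loss b (row n Z) y) \<beta>)
                      (gradient (\<lambda>b. logistic_loss b (row n Z) y) \<beta>))"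

text \<open>The time horizon may be infinite. Derivatives are taken within the half-open
  time interval, hence two-sided for \<open>t > 0\<close> and one-sided at \<open>t = 0\<close>.\<close>

definition time_interval :: "ereal \<Rightarrow> real set"
  where "time_interval T = {t. 0 \<le> t \<and> ereal t < T}"

definition ngf_trajectory ::
    "real^'d^'n \<Rightarrow> real^'n \<Rightarrow> ereal \<Rightarrow> (real \<Rightarrow> real^'d) \<Rightarrow> bool"
  where "ngf_trajectory Z y T \<beta> \<longleftrightarrow>
    (\<forall>t\<in>time_interval T. \<exists>v.
      (\<beta> has_vector_derivative v) (at t within time_interval T) \<and>
      fisher_information Z (\<beta> t) *v v = - gradient (total_loss Z y) (\<beta> t))"

end

theory Submission
  imports Defs
begin

text \<open>
  Only the margins \<open>u = y\<^sub>n (z\<^sub>n \<bullet> \<beta>)\<close> matter. When the rows \<open>z\<^sub>n\<close> are linearly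
  independent, pairing the flow equation with a basis dual to them decouples it into the scalar
  equations \<open>u' = N (1 + exp (- u))\<close>, in which the data no longer occur. Instead of invoking
  uniqueness for this equation, solve it: \<open>w = exp u\<close> satisfies \<open>w' = N (w + 1)\<close>, so
  \<open>(exp u + 1) exp (- N t)\<close> is constant and the margins at time \<open>t\<close> are determined by those
  at time \<open>0\<close>. Since \<open>X\<close> and \<open>X A\<^sup>T\<close> both have independent rows, the theorem follows.
\<close>

text \<open>Differentiating the logarithm leaves the factor
  \<open>1 - logistic_prob y z \<beta>\<close>, which equals
  \<open>logistic_prob (- y) z \<beta>\<close>. In this form it can later be cancelled against a
  factor of the Fisher matrix.\<close>

lemma GDERIV_logistic_loss:
  "GDERIV (\<lambda>b. logistic_loss b z y) \<beta> :> (- y * logistic_prob (- y) z \<beta>) *\<^sub>R z"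
proof -
  have loss: "logistic_loss b z y = ln (1 + exp (- y * (z \<bullet> b)))" for b
    by (simp add: logistic_loss_def logistic_prob_def ln_div add_pos_pos)
  have "1 + exp (- y * (z \<bullet> \<beta>)) > 0" "1 + exp (y * (z \<bullet> \<beta>)) > 0"
    by (simp_all add: add_pos_pos)
  then have coeff: "exp (- y * (z \<bullet> \<beta>)) / (1 + exp (- y * (z \<bullet> \<beta>))) = logistic_prob (- y) z \<beta>"
    by (simp add: logistic_prob_def exp_minus field_simps)
  have "((\<lambda>b. ln (1 + exp (- y * (z \<bullet> b)))) has_derivative
      (\<lambda>h. exp (- y * (z \<bullet> \<beta>)) / (1 + exp (- y * (z \<bullet> \<beta>))) * (- y * (z \<bullet> h)))) (at \<beta>)"
    by (auto intro!: derivative_eq_intros add_pos_pos simp: field_simps)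
  then show ?thesis
    unfolding gderiv_def loss coeff by (simp add: inner_commute mult_ac)
qed

lemmas gradient_logistic_loss = GDERIV_logistic_loss[THEN gradient_eqI]

lemma gradient_total_loss:
  "gradient (total_loss Z y) \<beta> =
    (\<Sum>n\<in>UNIV. (- (y $ n) * logistic_prob (- (y $ n)) (row n Z) \<beta>) *\<^sub>R row n Z)"
proof (rule gradient_eqI)
  show "GDERIV (total_loss Z y) \<beta> :>
      (\<Sum>n\<in>UNIV. (- (y $ n) * logistic_prob (- (y $ n)) (row n Z) \<beta>) *\<^sub>R row n Z)"
    unfolding gderiv_def total_loss_def[abs_def] inner_sum_right
    by (rule has_derivative_sum) (rule GDERIV_logistic_loss[unfolded gderiv_def])
qed

lemma outer_product_mult_vec: "outer_product u v *v x = (v \<bullet> x) *\<^sub>R u"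
  by (simp add: vec_eq_iff outer_product_def matrix_vector_mult_def inner_vec_def
      sum_distrib_left sum_distrib_right mult_ac)

lemma sum_matrix_vector_mult: "(\<Sum>i\<in>S. M i) *v x = (\<Sum>i\<in>S. M i *v x)"
  by (induction S rule: infinite_finite_induct) (simp_all add: matrix_vector_mult_add_rdistrib)

text \<open>Both possible gradients are multiples of the row, so each summand has rank at most one.
  With \<open>p\<close> and \<open>q\<close> the two label probabilities, its weight is
  \<open>p * q^2 + q * p^2 = p * q\<close>, the variance of a Bernoulli variable.\<close>

lemma fisher_information_mult_vec:
  fixes Z :: "real^'d^'n"
  shows "fisher_information Z \<beta> *v v =
    (1 / real CARD('n)) *\<^sub>R (\<Sum>n\<in>UNIV.
      (logistic_prob 1 (row n Z) \<beta> * logistic_prob (- 1) (row n Z) \<beta> * (row n Z \<bullet> v)) *\<^sub>R row n Z)"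
proof -
  have "(\<Sum>y\<in>{-1, 1}. logistic_prob y z \<beta> *\<^sub>R
        outer_product (gradient (\<lambda>b. logistic_loss b z y) \<beta>)
                      (gradient (\<lambda>b. logistic_loss b z y) \<beta>)) *v v =
      (logistic_prob 1 z \<beta> * logistic_prob (- 1) z \<beta> * (z \<bullet> v)) *\<^sub>R z" for z :: "real^'d"
  proof -
    define p q where "p = logistic_prob 1 z \<beta>" and "q = logistic_prob (- 1) z \<beta>"
    have "p + q = 1"
      using sum_logistic_prob[of z \<beta>] by (simp add: p_def q_def)
    then have "q * p * p + p * q * q = p * q" by algebra
    then have "(q * p * p) *\<^sub>R (z \<bullet> v) *\<^sub>R z + (p * q * q) *\<^sub>R (z \<bullet> v) *\<^sub>R z = (p * q) *\<^sub>R (z \<bullet> v) *\<^sub>R z"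
      by (metis scaleR_add_left)
    then show ?thesis
      unfolding sum_matrix_vector_mult gradient_logistic_loss
      by (simp add: scaleR_matrix_vector_assoc[symmetric] outer_product_mult_vec mult_ac
          flip: p_def q_def)
  qed
  then show ?thesis
    by (simp add: fisher_information_def scaleR_matrix_vector_assoc[symmetric]
        sum_matrix_vector_mult)
qed

lemma ngf_velocity:
  fixes Z :: "real^'d^'n"
  assumes "surj ((*v) Z)" and y: "y $ n \<in> {-1, 1}"
    and flow: "fisher_information Z \<beta> *v v = - gradient (total_loss Z y) \<beta>"
  shows "y $ n * (row n Z \<bullet> v) = real CARD('n) * (1 + exp (- (y $ n * (row n Z \<bullet> \<beta>))))"
proof -
  \<comment> \<open>Surjectivity encodes independence of the rows; \<open>w\<close> is the dual
    vector that isolates the \<open>n\<close>-th term of each sum.\<close>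
  obtain w where w: "Z *v w = axis n 1"
    using assms(1) by (metis surjD)
  have dual: "row k Z \<bullet> w = (if k = n then 1 else 0)" for k
    using arg_cong[OF w, of "\<lambda>u. u $ k"]
    by (simp add: matrix_vector_mult_def inner_vec_def row_def axis_def)
  define p where "p = (\<lambda>s. logistic_prob s (row n Z) \<beta>)"
  have p_nz: "p s \<noteq> 0" for s
    using logistic_prob_pos[of s "row n Z" \<beta>] by (simp add: p_def)
  have "(fisher_information Z \<beta> *v v) \<bullet> w = (- gradient (total_loss Z y) \<beta>) \<bullet> w"
    using flow by simp
  then have "p 1 * p (- 1) * (row n Z \<bullet> v) / real CARD('n) = y $ n * p (- (y $ n))"
    by (simp add: fisher_information_mult_vec gradient_total_loss inner_sum_left dual p_def
        if_distrib[of "\<lambda>u. _ * u"] sum_negf cong: if_cong)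
  \<comment> \<open>The Fisher weight is symmetric in the two labels, so it can be written with the
    observed one; then \<open>p (- (y $ n))\<close> cancels.\<close>
  moreover have "p 1 * p (- 1) = p (y $ n) * p (- (y $ n))"
    using y by auto
  ultimately have "p (y $ n) * (row n Z \<bullet> v) = y $ n * real CARD('n)"
    using p_nz[of "- (y $ n)"] by (simp add: field_simps)
  then have "y $ n * (row n Z \<bullet> v) = real CARD('n) / p (y $ n)"
    using y p_nz[of 1] p_nz[of "- 1"] by (auto simp: field_simps)
  then show ?thesis
    by (simp add: p_def logistic_prob_def)
qed

lemma ngf_margin:
  fixes Z :: "real^'d^'n"
  assumes surj: "surj ((*v) Z)" and y: "y $ n \<in> {-1, 1}"
    and ngf: "ngf_trajectory Z y T \<beta>" and t: "t \<in> time_interval T"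
  shows "exp (y $ n * (row n Z \<bullet> \<beta> t)) + 1 =
    (exp (y $ n * (row n Z \<bullet> \<beta> 0)) + 1) * exp (real CARD('n) * t)"
proof -
  let ?N = "real CARD('n)"
  define u where "u = (\<lambda>t. y $ n * (row n Z \<bullet> \<beta> t))"
  let ?c = "\<lambda>t. (exp (u t) + 1) * exp (- (?N * t))"
  have "(?c has_derivative (\<lambda>h. 0)) (at s within time_interval T)"
    if s: "s \<in> time_interval T" for s
  proof -
    obtain v where \<beta>: "(\<beta> has_vector_derivative v) (at s within time_interval T)"
      and flow: "fisher_information Z (\<beta> s) *v v = - gradient (total_loss Z y) (\<beta> s)"
      using ngf s unfolding ngf_trajectory_def by blast
    have v: "y $ n * (row n Z \<bullet> v) = ?N * (1 + exp (- u s))"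
      using ngf_velocity[OF surj y flow] by (simp add: u_def)
    have "(u has_derivative (\<lambda>h. y $ n * (row n Z \<bullet> (h *\<^sub>R v))))
        (at s within time_interval T)"
      using \<beta> unfolding has_vector_derivative_def u_def
      by (intro has_derivative_mult_right has_derivative_inner_right)
    then have u: "(u has_real_derivative ?N * (1 + exp (- u s))) (at s within time_interval T)"
      unfolding has_field_derivative_def v[symmetric] by (simp add: mult_commute_abs mult_ac)
    \<comment> \<open>Multiplying the velocity by \<open>exp u\<close> makes the equation linear, so
      that the two terms of the product rule for \<open>?c\<close> cancel.\<close>
    have "exp (u s) * (1 + exp (- u s)) = exp (u s) + 1"
      by (simp add: distrib_left mult_exp_exp)
    then have "exp (u s) * (?N * (1 + exp (- u s))) = ?N * (exp (u s) + 1)"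
      by (metis mult.left_commute)
    then have "(?c has_real_derivative 0) (at s within time_interval T)"
      by (auto intro!: derivative_eq_intros u)
    then show ?thesis
      by (simp add: has_field_derivative_def lambda_zero)
  qed
  \<comment> \<open>A vanishing derivative within a set forces constancy when the set is convex;
    this also covers an infinite horizon and the one-sided derivative at 0.\<close>
  moreover have "is_interval (time_interval T)"
    unfolding is_interval_1 time_interval_def
    by (cases T) auto
  moreover have "0 \<in> time_interval T"
    using t unfolding time_interval_def by (cases T) auto
  ultimately have "?c t = ?c 0"
    using t has_derivative_zero_unique[of "time_interval T" ?c]
    by (simp add: is_interval_convex)
  then show ?thesis
    by (simp add: u_def exp_minus field_simps)
qed

theorem theorem1:
  fixes X :: "real^'d^'n" and y :: "real^'n" and A :: "real^'d^'d"
    and T :: ereal and \<beta> \<beta>' :: "real \<Rightarrow> real^'d"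
  assumes "CARD('n) < CARD('d)"
    and "rank X = CARD('n)"
    and "\<forall>n. y $ n \<in> {-1, 1}"
    and "\<exists>\<beta>star :: real^'d. \<forall>n. y $ n * (row n X \<bullet> \<beta>star) \<ge> 1"
    and "invertible A"
    and "ngf_trajectory X y T \<beta>"
    and "ngf_trajectory (X ** transpose A) y T \<beta>'"
    and "X *v \<beta> 0 = (X ** transpose A) *v \<beta>' 0"
  shows "\<forall>t\<in>time_interval T. X *v \<beta> t = (X ** transpose A) *v \<beta>' t"
proof
  fix t assume t: "t \<in> time_interval T"
  let ?Z = "X ** transpose A"
  have surjX: "surj ((*v) X)"
    using assms(2) by (simp add: full_rank_surjective)
  \<comment> \<open>Transposing a left inverse of \<open>A\<close> gives a right inverse of
    \<open>transpose A\<close>.\<close>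
  have "surj ((*v) (transpose A))"
    using assms(5) unfolding invertible_def matrix_right_invertible_surjective[symmetric]
    by (metis matrix_transpose_mul transpose_mat)
  then have surjZ: "surj ((*v) ?Z)"
    using comp_surj[OF _ surjX, of "(*v) (transpose A)"]
    unfolding comp_def matrix_vector_mul_assoc by blast
  have comp: "(W *v b) $ n = row n W \<bullet> b" for W :: "real^'d^'n" and b n
    by (simp add: matrix_vector_mult_def inner_vec_def row_def)
  have "row n X \<bullet> \<beta> t = row n ?Z \<bullet> \<beta>' t" for n
  proof -
    have y: "y $ n \<in> {-1, 1}" using assms(3) by simp
    have "row n X \<bullet> \<beta> 0 = row n ?Z \<bullet> \<beta>' 0"
      using assms(8) comp by metis
    \<comment> \<open>Both closed forms have the same growth factor and the same initial margin.
      Injectivity of \<open>exp\<close> and \<open>y $ n \<noteq> 0\<close> then recover the inner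
      products.\<close>
    then have "exp (y $ n * (row n X \<bullet> \<beta> t)) + 1 = exp (y $ n * (row n ?Z \<bullet> \<beta>' t)) + 1"
      unfolding ngf_margin[OF surjX y assms(6) t] ngf_margin[OF surjZ y assms(7) t] by simp
    then show ?thesis
      using y by auto
  qed
  then show "X *v \<beta> t = ?Z *v \<beta>' t"
    by (simp add: vec_eq_iff comp)
qed

end
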